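(* Let $(O,Q)$ be an HMM realization of order $k$ of the stationary process $\{y_t\}$ with deterministic observation $\phi$, let $\rho$ be the stationary distribution of the state, and let the tensor $M$, the matrices $A,B,C$, the subspaces $V_R$, $V_{R,u}$, $V_N$ and the objects $T_R,\hat\phi_R,\hat e_R,\hat Q_R,\hat O_R,\hat\rho_R,T_N$ be as defined in the context (for a fixed integer $n\ge1$). Assume $V_{R,u}\not\subset\ker e^{\mathrm T}$ for every $u=1,\ldots,d$. Let $\hat k=\dim\,(V_R+V_N)/V_N$ and $\hat k_R=\dim V_R$. Let $T=(t_{ij})\in\mathbb{R}^{\hat k\times\hat k_R}$ be a full-row-rank matrix and $\hat\phi:\{1,\ldots,\hat k\}\to\{1,\ldots,d\}$ a map such that (i) $t_{ij}=0$ if $\hat\phi(i)\ne\hat\phi_R(j)$; (ii) $\ker T=\ker T_NT_R$; (iii) $\hat e_R^{\mathrm T}=\hat e^{\mathrm T}T$, where $\hat e\in\mathbb{R}^{\hat k}$ is the all-ones vector; (iv) $\hat Q_R\ker T\subset\ker T$. Define $\hat Q\in\mathbb{R}^{\hat k\times\hat k}$, $\hat O\in\mathbb{R}^{d\times\hat k}$ and $\hat\rho\in\mathbb{R}^{\hat k}$ by $\hat QT=T\hat Q_R$, $\hat OT=\hat O_R$ and $\hat\rho=T\hat\rho_R$. Let $\hat I_u\in\mathbb{R}^{\hat k\times\hat k}$ be the diagonal matrix whose $(i,i)$th element is $1$ if $\hat\phi(i)=u$ and $0$ otherwise. Define $\hat A,\hat B\in\mathbb{R}^{d^n\times\hat k}$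 and $\hat C\in\mathbb{R}^{d\times\hat k}$ by giving their $L(u_1^n)$th rows, for $u_1^n=(u_1,\ldots,u_n)\in\{1,\ldots,d\}^n$, $$\hat A_{L(u_1^n)}=\hat e^{\mathrm T}\hat I_{u_n}\hat Q\cdots\hat I_{u_1}\hat Q,\qquad \hat B_{L(u_1^n)}=\hat\rho^{\mathrm T}\hat I_{u_n}\hat Q^{\mathrm T}\cdots\hat I_{u_1}\hat Q^{\mathrm T},\qquad \hat C=\hat O .$$ Then $$M=A\otimes B\otimes C=\hat A\otimes\hat B\otimes\hat C .$$
   Context: Realization: $\{y_t\}_{t\in\mathbb{Z}}$ is a stationary process with values in $\{1,\ldots,d\}$. $\{x_t\}_{t\in\mathbb{Z}}$ is a stationary Markov chain on $\{1,\ldots,k\}$ with transition matrix $Q=(q_{ij})\in\mathbb{R}^{k\times k}$, $q_{ij}=\mathbb{P}(x_{t+1}=i\mid x_t=j)$ (so $Q$ is nonnegative and each column sums to one). $\phi:\{1,\ldots,k\}\to\{1,\ldots,d\}$ is a map, and $O=(o_{ij})\in\mathbb{R}^{d\times k}$ has $o_{ij}=1$ if $\phi(j)=i$ and $o_{ij}=0$ otherwise. "$(O,Q)$ is an HMM realization of order $k$ with deterministic observation $\phi$" means that $\{y_t\}$ and $\{\phi(x_t)\}$ have the same law. $e\in\mathbb{R}^k$ is the all-ones vector, so $e^{\mathrm T}Q=e^{\mathrm T}$; $\rho\in\mathbb{R}^k$ is the stationary distribution of $\{x_t\}$, $\rho_i=\mathbb{P}(x_t=i)$, so $Q\rho=\rho$.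 For $u=1,\ldots,d$, $I_u\in\mathbb{R}^{k\times k}$ is the diagonal matrix whose $(i,i)$th element is $1$ if $\phi(i)=u$ and $0$ otherwise. Subspaces: $V_R=\operatorname{span}\{I_{u_n}Q\cdots I_{u_1}QI_{u_0}\rho: (u_0,\ldots,u_n)\in\{1,\ldots,d\}^{n+1},\ n=0,1,2,\ldots\}$ (reachable subspace), $V_{R,u}=I_uV_R$, and $V_N=\bigcap\{v\in\mathbb{R}^k: e^{\mathrm T}I_{u_n}Q\cdots I_{u_1}QI_{u_0}v=0\}$ (null space), the intersection being over all $(u_0,\ldots,u_n)\in\{1,\ldots,d\}^{n+1}$ and all $n=0,1,2,\ldots$. The effective space is $(V_R+V_N)/V_N$. Bases: $T_R=(t_{R,ij})\in\mathbb{R}^{k\times\hat k_R}$ is a full-column-rank matrix and $\hat\phi_R:\{1,\ldots,\hat k_R\}\to\{1,\ldots,d\}$ a map with $t_{R,ij}=0$ if $\phi(i)\neq\hat\phi_R(j)$, $V_R=\operatorname{ran}T_R$ (column space), and $e^{\mathrm T}T_R=\hat e_R^{\mathrm T}$, where $\hat e_R\in\mathbb{R}^{\hat k_R}$ is the all-ones vector. With $\hat k_N=k-\dim V_N$, $T_N=(t_{N,ij})\in\mathbb{R}^{\hat k_N\times k}$ is a full-row-rank matrix, with an accompanying map $\hat\phi_N:\{1,\ldots,\hat k_N\}\to\{1,\ldots,d\}$, such that $t_{N,ij}=0$ if $\hat\phi_N(i)\neq\phi(j)$, $V_N=\ker T_N$, and $e^{\mathrm T}=\hat e_N^{\mathrm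 T}T_N$ with $\hat e_N\in\mathbb{R}^{\hat k_N}$ the all-ones vector. $\hat Q_R\in\mathbb{R}^{\hat k_R\times\hat k_R}$, $\hat O_R\in\mathbb{R}^{d\times\hat k_R}$, $\hat\rho_R\in\mathbb{R}^{\hat k_R}$ are defined by $QT_R=T_R\hat Q_R$, $\hat O_R=OT_R$, $\rho=T_R\hat\rho_R$ (well defined because $V_R$ is $Q$-invariant and contains $\rho$). Tensor: for $u_1^n=(u_1,\ldots,u_n)\in\{1,\ldots,d\}^n$ put $L(u_1^n)=(u_1-1)d^{n-1}+(u_2-1)d^{n-2}+\cdots+(u_{n-1}-1)d+u_n\in\{1,\ldots,d^n\}$. $M\in\mathbb{R}^{d^n\times d^n\times d}$ is the third-order tensor with entries $M_{L(u_1,\ldots,u_n),\,L(u_{-1},\ldots,u_{-n}),\,u_0}=\mathbb{P}\{y_t=u_t \text{ for all } t=-n,\ldots,n\}$. The matrices $A,B\in\mathbb{R}^{d^n\times k}$ and $C\in\mathbb{R}^{d\times k}$ are given by rows $A_{L(u_1^n)}=e^{\mathrm T}I_{u_n}Q\cdots I_{u_1}Q$, $B_{L(u_1^n)}=\rho^{\mathrm T}I_{u_n}Q^{\mathrm T}\cdots I_{u_1}Q^{\mathrm T}$, and $C=O$. For matrices $X,Y,Z$ with the same number $r$ of columns $x_i,y_i,z_i$, $X\otimes Y\otimes Z$ denotes the third-order tensor $\sum_{i=1}^r x_i\otimes y_i\otimes z_i$ (a sum of $r$ rank-one tensors). *)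

theory Defs
  imports
    "HOL-Probability.Probability"
    "HOL-Algebra.AbelCoset"
    "Jordan_Normal_Form.Matrix_Kernel"
    "Jordan_Normal_Form.DL_Rank"
begin

unbundle no vec_syntax

text \<open>
  Indices are zero-based, as usual for \<^typ>\<open>'a mat\<close>: symbols range over \<open>{..<d}\<close>, states over
  \<open>{..<k}\<close>, and a row \<open>L(u)\<close> of a one-based text becomes row \<open>L(u) - 1\<close>.
\<close>

section \<open>Processes with finitely many values\<close>

definition finite_process :: "'a measure \<Rightarrow> nat \<Rightarrow> (int \<Rightarrow> 'a \<Rightarrow> nat) \<Rightarrow> bool" where
  "finite_process P d y \<longleftrightarrow> prob_space P \<and> (\<forall>t. y t \<in> P \<rightarrow>\<^sub>M count_space {..<d})"

definition process_law :: "'a measure \<Rightarrow> nat \<Rightarrow> (int \<Rightarrow> 'a \<Rightarrow> nat) \<Rightarrow> (int \<Rightarrow> nat) measure" where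
  "process_law P d y = distr P (Pi\<^sub>M UNIV (\<lambda>_. count_space {..<d})) (\<lambda>\<omega> t. y t \<omega>)"

definition stationary_process :: "'a measure \<Rightarrow> nat \<Rightarrow> (int \<Rightarrow> 'a \<Rightarrow> nat) \<Rightarrow> bool" where
  "stationary_process P d y \<longleftrightarrow>
     finite_process P d y \<and> (\<forall>s. process_law P d (\<lambda>t. y (t + s)) = process_law P d y)"

text \<open>
  Column convention: \<open>Q $$ (i, j)\<close> is the probability of moving from \<open>j\<close> to \<open>i\<close>.  The matrix is
  required to be stochastic even in columns of states that are never visited, where the
  conditional probabilities do not determine it.
\<close>

definition column_stochastic :: "nat \<Rightarrow> real mat \<Rightarrow> bool" where
  "column_stochastic k Q \<longleftrightarrow> Q \<in> carrier_mat k k \<and>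
     (\<forall>i<k. \<forall>j<k. 0 \<le> Q $$ (i, j)) \<and> (\<forall>j<k. (\<Sum>i<k. Q $$ (i, j)) = 1)"

definition markov_chain :: "'a measure \<Rightarrow> nat \<Rightarrow> real mat \<Rightarrow> (int \<Rightarrow> 'a \<Rightarrow> nat) \<Rightarrow> bool" where
  "markov_chain P k Q x \<longleftrightarrow>
     finite_process P k x \<and> column_stochastic k Q \<and>
     (\<forall>t m a i.
        \<P>(\<omega> in P. \<forall>s\<in>{t - int m..t}. x s \<omega> = a s) \<noteq> 0 \<longrightarrow>
        \<P>(\<omega> in P. x (t + 1) \<omega> = i \<bar> \<forall>s\<in>{t - int m..t}. x s \<omega> = a s) =
        \<P>(\<omega> in P. x (t + 1) \<omega> = i \<bar> x t \<omega> = a t)) \<and>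
     (\<forall>t. \<forall>i<k. \<forall>j<k.
        \<P>(\<omega> in P. x t \<omega> = j) \<noteq> 0 \<longrightarrow>
        \<P>(\<omega> in P. x (t + 1) \<omega> = i \<bar> x t \<omega> = j) = Q $$ (i, j))"

definition observation_mat :: "nat \<Rightarrow> nat \<Rightarrow> (nat \<Rightarrow> nat) \<Rightarrow> real mat" where
  "observation_mat d k \<phi> = Matrix.mat d k (\<lambda>(i, j). if \<phi> j = i then 1 else 0)"

definition hmm_realization ::
  "'a measure \<Rightarrow> (int \<Rightarrow> 'a \<Rightarrow> nat) \<Rightarrow> nat \<Rightarrow> 'b measure \<Rightarrow> (int \<Rightarrow> 'b \<Rightarrow> nat) \<Rightarrow> nat \<Rightarrow>
   (nat \<Rightarrow> nat) \<Rightarrow> real mat \<Rightarrow> real mat \<Rightarrow> bool" where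
  "hmm_realization P y d P' x k \<phi> Ob Q \<longleftrightarrow>
     stationary_process P' k x \<and> markov_chain P' k Q x \<and>
     \<phi> \<in> {..<k} \<rightarrow> {..<d} \<and> Ob = observation_mat d k \<phi> \<and>
     process_law P d y = process_law P' d (\<lambda>t \<omega>. \<phi> (x t \<omega>))"

section \<open>Word products\<close>

abbreviation ones :: "nat \<Rightarrow> real vec" where
  "ones k \<equiv> Matrix.vec k (\<lambda>_. 1)"

text \<open>The row vector \<open>v\<^sup>T X\<close>, as a vector.\<close>

abbreviation row_mult :: "real vec \<Rightarrow> real mat \<Rightarrow> real vec" where
  "row_mult v X \<equiv> transpose_mat X *\<^sub>v v"

definition symbol_mat :: "nat \<Rightarrow> (nat \<Rightarrow> nat) \<Rightarrow> nat \<Rightarrow> real mat" where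
  "symbol_mat k \<phi> u = mat_diag k (\<lambda>i. if \<phi> i = u then 1 else 0)"

text \<open>For \<open>[u\<^sub>1, \<dots>, u\<^sub>n]\<close> this is \<open>I u\<^sub>n Q \<cdots> I u\<^sub>1 Q\<close>: the first letter is the rightmost factor.\<close>

fun word_mat :: "nat \<Rightarrow> (nat \<Rightarrow> nat) \<Rightarrow> real mat \<Rightarrow> nat list \<Rightarrow> real mat" where
  "word_mat k \<phi> Q [] = 1\<^sub>m k"
| "word_mat k \<phi> Q (u # us) = word_mat k \<phi> Q us * (symbol_mat k \<phi> u * Q)"

definition words :: "nat \<Rightarrow> nat \<Rightarrow> nat list set" where
  "words d n = {us. set us \<subseteq> {..<d} \<and> length us = n}"

definition word_index :: "nat \<Rightarrow> nat list \<Rightarrow> nat" where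
  "word_index d us = (\<Sum>i<length us. us ! i * d ^ (length us - Suc i))"

section \<open>Reachable, null and effective spaces\<close>

abbreviation vspan :: "nat \<Rightarrow> real vec set \<Rightarrow> real vec set" where
  "vspan k \<equiv> LinearCombinations.module.span class_ring (module_vec TYPE(real) k)"

abbreviation subspace_of_vec :: "nat \<Rightarrow> real vec set \<Rightarrow> (real, real vec) module" where
  "subspace_of_vec k W \<equiv> (module_vec TYPE(real) k)\<lparr>carrier := W\<rparr>"

abbreviation vdim :: "nat \<Rightarrow> real vec set \<Rightarrow> nat" where
  "vdim k W \<equiv> vectorspace.dim class_ring (subspace_of_vec k W)"

definition reachable_space :: "nat \<Rightarrow> nat \<Rightarrow> (nat \<Rightarrow> nat) \<Rightarrow> real mat \<Rightarrow> real vec \<Rightarrow> real vec set" where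
  "reachable_space d k \<phi> Q \<rho> =
     vspan k {(word_mat k \<phi> Q us * symbol_mat k \<phi> u\<^sub>0) *\<^sub>v \<rho> | us u\<^sub>0. u\<^sub>0 < d \<and> set us \<subseteq> {..<d}}"

definition null_space :: "nat \<Rightarrow> nat \<Rightarrow> (nat \<Rightarrow> nat) \<Rightarrow> real mat \<Rightarrow> real vec set" where
  "null_space d k \<phi> Q =
     {v \<in> carrier_vec k. \<forall>us u\<^sub>0. u\<^sub>0 < d \<and> set us \<subseteq> {..<d} \<longrightarrow>
        scalar_prod (ones k) ((word_mat k \<phi> Q us * symbol_mat k \<phi> u\<^sub>0) *\<^sub>v v) = 0}"

definition vec_set_sum :: "real vec set \<Rightarrow> real vec set \<Rightarrow> real vec set" where
  "vec_set_sum V W = {v + w | v w. v \<in> V \<and> w \<in> W}"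

text \<open>
  The quotient by a submodule, with cosets as elements.  The ring fields \<^const>\<open>mult\<close> and
  \<^const>\<open>one\<close> of the record have no meaning for modules.
\<close>

definition quot_module :: "('a, 'b, 'c) module_scheme \<Rightarrow> 'b set \<Rightarrow> ('a, 'b set) module" where
  "quot_module M U =
     \<lparr>carrier = A_RCOSETS M U, mult = undefined, one = undefined, zero = U, add = set_add M,
      smult = (\<lambda>a X. \<Union>x\<in>X. a_r_coset M U (a \<odot>\<^bsub>M\<^esub> x))\<rparr>"

text \<open>The dimension of \<open>W / U\<close> for subspaces \<open>U \<subseteq> W\<close> of the space of \<open>k\<close>-vectors.\<close>

definition quot_dim :: "nat \<Rightarrow> real vec set \<Rightarrow> real vec set \<Rightarrow> nat" where
  "quot_dim k W U = vectorspace.dim class_ring (quot_module (subspace_of_vec k W) U)"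

section \<open>Third-order tensors\<close>

text \<open>
  A tensor of format \<open>a \<times> b \<times> c\<close> is a function of three indices that vanishes outside the format,
  so that equality of tensors is equality of functions.
\<close>

type_synonym tensor3 = "nat \<Rightarrow> nat \<Rightarrow> nat \<Rightarrow> real"

definition carrier_tensor3 :: "nat \<Rightarrow> nat \<Rightarrow> nat \<Rightarrow> tensor3 set" where
  "carrier_tensor3 a b c = {M. \<forall>i j l. \<not> (i < a \<and> j < b \<and> l < c) \<longrightarrow> M i j l = 0}"

definition rank_one_tensor3 :: "real vec \<Rightarrow> real vec \<Rightarrow> real vec \<Rightarrow> tensor3" where
  "rank_one_tensor3 x y z =
     (\<lambda>i j l. if i < dim_vec x \<and> j < dim_vec y \<and> l < dim_vec z then x $ i * y $ j * z $ l else 0)"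

definition tensor3_of_mats :: "real mat \<Rightarrow> real mat \<Rightarrow> real mat \<Rightarrow> tensor3" where
  "tensor3_of_mats X Y Z =
     (\<lambda>i j l. \<Sum>r<dim_col X. rank_one_tensor3 (col X r) (col Y r) (col Z r) i j l)"

end

theory Submission
  imports Defs
begin

text \<open>
  Write \<open>J(us, w, vs) = e\<^sup>T I\<^sub>u\<^sub>n Q \<cdots> I\<^sub>u\<^sub>1 Q I\<^sub>w Q I\<^sub>v\<^sub>1 \<cdots> Q I\<^sub>v\<^sub>n \<rho>\<close>.  This is the tensor entry of the given
  realization, and since \<open>Q \<rho> = \<rho>\<close> the Markov property identifies it with the path probability.
  Any matrix \<open>X\<close> that respects the symbols and satisfies \<open>X Q\<^sub>1 = Q\<^sub>2 X\<close> and \<open>e\<^sub>2\<^sup>T X = e\<^sub>1\<^sup>T\<close> leaves \<open>J\<close>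
  unchanged when \<open>\<rho>\<^sub>1\<close> is replaced by \<open>X \<rho>\<^sub>1\<close>.  Both \<open>TR\<close> and \<open>T\<close> are such matrices, starting from
  the reachable realization.  The reduced tensor has entry \<open>J\<close> too once \<open>Oh\<close> is known to be the
  observation matrix of \<open>\<phi>h\<close>, which holds because \<open>T\<close> has full row rank and can be cancelled.
\<close>

section \<open>Intertwining matrices\<close>

text \<open>A maximal independent set of columns has as many elements as the rank. Here that number
  is the dimension \<open>m\<close>, so the set is a basis and the columns span everything.\<close>

lemma full_row_rank_surj:
  fixes T :: "'a :: field mat"
  assumes T: "T \<in> carrier_mat m c" and rank: "vec_space.rank m T = m" and v: "v \<in> carrier_vec m"
  obtains w where "w \<in> carrier_vec c" "T *\<^sub>v w = v"
proof -
  interpret vec_space "TYPE('a)" m .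
  \<comment> \<open>The maximal set is grown from the empty set, and independent sets in dimension
    \<open>m\<close> are bounded in size.\<close>
  obtain S where S: "finite S" "maximal S (\<lambda>U. U \<subseteq> set (cols T) \<and> lin_indpt U)"
    using maximal_exists_superset[of "set (cols T)" "\<lambda>U. U \<subseteq> set (cols T) \<and> lin_indpt U" "{}"]
      finite_lin_indpt2[of "{}"] by auto
  have sub: "S \<subseteq> set (cols T)" and li: "lin_indpt S"
    using S(2) by (auto simp: maximal_def)
  have colsT: "set (cols T) \<subseteq> carrier_vec m"
    using cols_dim T by blast
  have "card S = m"
    using rank_card_indpt[OF T S(2)] rank by simp
  then have "basis S"
    using dim_li_is_basis[OF fin_dim S(1) _ li] sub colsT dim_is_n by auto
  then have "span S = carrier_vec m"
    by (simp add: basis_def)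
  moreover have "span S \<subseteq> span (set (cols T))"
    by (rule span_is_monotone[OF sub])
  ultimately have "v \<in> col_space T"
    using v by (auto simp: col_space_def)
  then show thesis
    using that T by (auto simp: col_space_eq[OF T])
qed

lemma mult_unit_vec_col:
  fixes X :: "'a :: semiring_1 mat"
  assumes "X \<in> carrier_mat p m" "j < m"
  shows "X *\<^sub>v unit_vec m j = col X j"
  using assms by (intro eq_vecI) auto

text \<open>Every unit vector is hit by \<open>T\<close>, so \<open>X\<close> and \<open>Y\<close>
  agree on all unit vectors, that is, column by column. This is how a matrix given only through its
  product with \<open>T\<close> gets identified.\<close>

lemma full_row_rank_cancel:
  fixes T :: "'a :: field mat"
  assumes T: "T \<in> carrier_mat m c" "vec_space.rank m T = m"
    and X: "X \<in> carrier_mat p m" and Y: "Y \<in> carrier_mat p m" and eq: "X * T = Y * T"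
  shows "X = Y"
proof (rule eq_matI)
  fix i j assume "i < dim_row Y" "j < dim_col Y"
  then have ij: "i < p" "j < m" using Y by auto
  obtain w where w: "w \<in> carrier_vec c" "T *\<^sub>v w = unit_vec m j"
    using full_row_rank_surj[OF T unit_vec_carrier] by blast
  have "X *\<^sub>v unit_vec m j = Y *\<^sub>v unit_vec m j"
    using assoc_mult_mat_vec[OF X T(1) w(1)] assoc_mult_mat_vec[OF Y T(1) w(1)] eq w(2) by simp
  then have "col X j = col Y j"
    using X Y ij(2) by (simp add: mult_unit_vec_col)
  then show "X $$ (i, j) = Y $$ (i, j)"
    using X Y ij by (metis carrier_matD index_col)
qed (use X Y in auto)

section \<open>Symbol matrices as coordinate masks, and word products\<close>

lemma symbol_mat_carrier [simp]: "symbol_mat k \<phi> u \<in> carrier_mat k k"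
  by (simp add: symbol_mat_def)

lemma symbol_mat_mult_vec:
  assumes v: "v \<in> carrier_vec k" and i: "i < k"
  shows "(symbol_mat k \<phi> u *\<^sub>v v) $ i = (if \<phi> i = u then v $ i else 0)"
proof -
  have "(symbol_mat k \<phi> u *\<^sub>v v) $ i =
      (\<Sum>l = 0..<k. (if i = l then if \<phi> l = u then 1 else 0 else 0) * v $ l)"
    using v i by (simp add: symbol_mat_def mat_diag_def scalar_prod_def)
  also have "\<dots> = (\<Sum>l = 0..<k. if i = l then (if \<phi> l = u then 1 else 0) * v $ l else 0)"
    by (rule sum.cong) auto
  also have "\<dots> = (if \<phi> i = u then v $ i else 0)"
    using i by simp
  finally show ?thesis .
qed

lemma symbol_mat_transpose [simp]: "transpose_mat (symbol_mat k \<phi> u) = symbol_mat k \<phi> u"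
  by (rule eq_matI) (auto simp: symbol_mat_def mat_diag_def)

lemma word_mat_carrier [simp]:
  "Q \<in> carrier_mat k k \<Longrightarrow> word_mat k \<phi> Q us \<in> carrier_mat k k"
  by (induction us) (auto intro!: mult_carrier_mat[where n = k])

text \<open>The order flips because later letters stand further to the left in the product.\<close>

lemma word_mat_append:
  assumes Q: "Q \<in> carrier_mat k k"
  shows "word_mat k \<phi> Q (us @ vs) = word_mat k \<phi> Q vs * word_mat k \<phi> Q us"
proof (induction us)
  case Nil
  show ?case using right_mult_one_mat[OF word_mat_carrier[OF Q]] by simp
next
  case (Cons u us)
  have "symbol_mat k \<phi> u * Q \<in> carrier_mat k k"
    using Q by (intro mult_carrier_mat[where n = k]) auto
  then show ?case
    using Cons by (simp add: assoc_mult_mat[OF word_mat_carrier[OF Q] word_mat_carrier[OF Q]])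
qed

text \<open>Multiplying on the right masks columns by \<open>\<phi>1\<close>, multiplying on the
  left masks rows by \<open>\<phi>2\<close>. The two masks agree wherever \<open>X\<close> is
  nonzero.\<close>

lemma symbol_mat_intertwines:
  assumes X: "X \<in> carrier_mat k2 k1"
    and zero: "\<forall>i<k2. \<forall>j<k1. \<phi>2 i \<noteq> \<phi>1 j \<longrightarrow> X $$ (i, j) = 0"
  shows "X * symbol_mat k1 \<phi>1 u = symbol_mat k2 \<phi>2 u * X"
  unfolding symbol_mat_def mat_diag_mult_left[OF X] mat_diag_mult_right[OF X]
  using zero by (intro eq_matI) auto

text \<open>\<open>X\<close> is carried through the product one factor at a time, past symbol
  matrices by masking and past \<open>Q1\<close> by \<open>XQ\<close>.\<close>

lemma word_mat_intertwines:
  assumes X: "X \<in> carrier_mat k2 k1"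
    and zero: "\<forall>i<k2. \<forall>j<k1. \<phi>2 i \<noteq> \<phi>1 j \<longrightarrow> X $$ (i, j) = 0"
    and Q1: "Q1 \<in> carrier_mat k1 k1" and Q2: "Q2 \<in> carrier_mat k2 k2" and XQ: "X * Q1 = Q2 * X"
  shows "X * word_mat k1 \<phi>1 Q1 us = word_mat k2 \<phi>2 Q2 us * X"
proof (induction us)
  case Nil
  show ?case using X by simp
next
  case (Cons u us)
  note I = symbol_mat_intertwines[OF X zero]
  note C = symbol_mat_carrier[of k1 \<phi>1 u] symbol_mat_carrier[of k2 \<phi>2 u]
  note W = word_mat_carrier[OF Q1, of \<phi>1 us] word_mat_carrier[OF Q2, of \<phi>2 us]
  have "X * word_mat k1 \<phi>1 Q1 (u # us) = (X * word_mat k1 \<phi>1 Q1 us) * (symbol_mat k1 \<phi>1 u * Q1)"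
    using X C W Q1 by (simp add: assoc_mult_mat[OF X W(1) mult_carrier_mat[OF C(1) Q1]])
  also have "\<dots> = word_mat k2 \<phi>2 Q2 us * ((X * symbol_mat k1 \<phi>1 u) * Q1)"
    unfolding Cons assoc_mult_mat[OF W(2) X mult_carrier_mat[OF C(1) Q1]] assoc_mult_mat[OF X C(1) Q1] ..
  also have "\<dots> = word_mat k2 \<phi>2 Q2 us * ((symbol_mat k2 \<phi>2 u * Q2) * X)"
    unfolding I assoc_mult_mat[OF C(2) X Q1] XQ assoc_mult_mat[OF C(2) Q2 X] ..
  finally show ?case
    unfolding word_mat.simps assoc_mult_mat[OF W(2) mult_carrier_mat[OF C(2) Q2] X] .
qed

text \<open>Transposition turns the product around: for \<open>[v1, ..., vn]\<close> it is
  \<open>Q I_v1 Q I_v2 ... Q I_vn\<close>, with the first letter leftmost. This recursion drives the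
  inductions over the past word.\<close>

lemma transpose_word_mat_Cons:
  assumes Q: "Q \<in> carrier_mat k k"
  shows "transpose_mat (word_mat k \<phi> (transpose_mat Q) (v # vs)) =
    Q * (symbol_mat k \<phi> v * transpose_mat (word_mat k \<phi> (transpose_mat Q) vs))"
proof -
  have Qt: "transpose_mat Q \<in> carrier_mat k k" using Q by simp
  note C = symbol_mat_carrier[of k \<phi> v]
  note W = word_mat_carrier[OF Qt, of \<phi> vs]
  have "transpose_mat (word_mat k \<phi> (transpose_mat Q) (v # vs)) =
    (Q * symbol_mat k \<phi> v) * transpose_mat (word_mat k \<phi> (transpose_mat Q) vs)"
    by (simp add: transpose_mult[OF W mult_carrier_mat[OF C Qt]] transpose_mult[OF C Qt])
  then show ?thesis
    using W assoc_mult_mat[OF Q C, of _ k] by simp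
qed

text \<open>In the transposed product the first letter is outermost, so \<open>X\<close> passes
  \<open>Q1\<close>, then the symbol matrix, and then the rest by induction.\<close>

lemma transpose_word_mat_intertwines:
  assumes X: "X \<in> carrier_mat k2 k1"
    and zero: "\<forall>i<k2. \<forall>j<k1. \<phi>2 i \<noteq> \<phi>1 j \<longrightarrow> X $$ (i, j) = 0"
    and Q1: "Q1 \<in> carrier_mat k1 k1" and Q2: "Q2 \<in> carrier_mat k2 k2" and XQ: "X * Q1 = Q2 * X"
  shows "X * transpose_mat (word_mat k1 \<phi>1 (transpose_mat Q1) us) =
    transpose_mat (word_mat k2 \<phi>2 (transpose_mat Q2) us) * X"
proof (induction us)
  case Nil
  show ?case using X by simp
next
  case (Cons u us)
  note I = symbol_mat_intertwines[OF X zero, of u]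
  note C = symbol_mat_carrier[of k1 \<phi>1 u] symbol_mat_carrier[of k2 \<phi>2 u]
  define W1 where "W1 = transpose_mat (word_mat k1 \<phi>1 (transpose_mat Q1) us)"
  define W2 where "W2 = transpose_mat (word_mat k2 \<phi>2 (transpose_mat Q2) us)"
  have W: "W1 \<in> carrier_mat k1 k1" "W2 \<in> carrier_mat k2 k2"
    using Q1 Q2 by (auto simp: W1_def W2_def)
  have IH: "X * W1 = W2 * X" using Cons by (simp add: W1_def W2_def)
  have "X * (Q1 * (symbol_mat k1 \<phi>1 u * W1)) = (Q2 * X) * (symbol_mat k1 \<phi>1 u * W1)"
    unfolding XQ[symmetric] assoc_mult_mat[OF X Q1 mult_carrier_mat[OF C(1) W(1)]] ..
  also have "\<dots> = Q2 * ((X * symbol_mat k1 \<phi>1 u) * W1)"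
    unfolding assoc_mult_mat[OF Q2 X mult_carrier_mat[OF C(1) W(1)]] assoc_mult_mat[OF X C(1) W(1)] ..
  also have "\<dots> = Q2 * ((symbol_mat k2 \<phi>2 u * W2) * X)"
    unfolding I assoc_mult_mat[OF C(2) X W(1)] IH assoc_mult_mat[OF C(2) W(2) X] ..
  also have "\<dots> = (Q2 * (symbol_mat k2 \<phi>2 u * W2)) * X"
    unfolding assoc_mult_mat[OF Q2 mult_carrier_mat[OF C(2) W(2)] X] ..
  finally show ?case
    by (simp only: transpose_word_mat_Cons[OF Q1] transpose_word_mat_Cons[OF Q2] W1_def W2_def)
qed

text \<open>The word \<open>vs\<close> runs backwards in time from the middle letter \<open>w\<close>, as in the second tensor index.\<close>

definition joint_weight ::
  "nat \<Rightarrow> (nat \<Rightarrow> nat) \<Rightarrow> real mat \<Rightarrow> real vec \<Rightarrow> nat list \<Rightarrow> nat \<Rightarrow> nat list \<Rightarrow> real" where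
  "joint_weight k \<phi> Q \<rho> us w vs =
     scalar_prod (ones k) (word_mat k \<phi> Q us *\<^sub>v (symbol_mat k \<phi> w *\<^sub>v
       (transpose_mat (word_mat k \<phi> (transpose_mat Q) vs) *\<^sub>v \<rho>)))"

text \<open>Starting next to \<open>\<rho>\<close>, the factor \<open>X\<close> is carried to the
  left through past, middle letter and future until the ones vector absorbs it by \<open>e\<close>.
  Only linear relations enter, so \<open>Q1\<close> and \<open>Q2\<close> may have negative
  entries.\<close>

lemma joint_weight_intertwines:
  assumes X: "X \<in> carrier_mat k2 k1"
    and zero: "\<forall>i<k2. \<forall>j<k1. \<phi>2 i \<noteq> \<phi>1 j \<longrightarrow> X $$ (i, j) = 0"
    and Q1: "Q1 \<in> carrier_mat k1 k1" and Q2: "Q2 \<in> carrier_mat k2 k2" and XQ: "X * Q1 = Q2 * X"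
    and e: "row_mult (ones k2) X = ones k1" and \<rho>: "\<rho> \<in> carrier_vec k1"
  shows "joint_weight k2 \<phi>2 Q2 (X *\<^sub>v \<rho>) us w vs = joint_weight k1 \<phi>1 Q1 \<rho> us w vs"
proof -
  define B1 where "B1 = transpose_mat (word_mat k1 \<phi>1 (transpose_mat Q1) vs)"
  define B2 where "B2 = transpose_mat (word_mat k2 \<phi>2 (transpose_mat Q2) vs)"
  have B: "B1 \<in> carrier_mat k1 k1" "B2 \<in> carrier_mat k2 k2"
    using Q1 Q2 by (auto simp: B1_def B2_def)
  note W = word_mat_carrier[OF Q1, of \<phi>1 us] word_mat_carrier[OF Q2, of \<phi>2 us]
  note C = symbol_mat_carrier[of k1 \<phi>1 w] symbol_mat_carrier[of k2 \<phi>2 w]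
  have v: "B1 *\<^sub>v \<rho> \<in> carrier_vec k1" "symbol_mat k1 \<phi>1 w *\<^sub>v (B1 *\<^sub>v \<rho>) \<in> carrier_vec k1"
      "word_mat k1 \<phi>1 Q1 us *\<^sub>v (symbol_mat k1 \<phi>1 w *\<^sub>v (B1 *\<^sub>v \<rho>)) \<in> carrier_vec k1"
    using B C W \<rho> by (meson mult_mat_vec_carrier)+
  have "B2 *\<^sub>v (X *\<^sub>v \<rho>) = X *\<^sub>v (B1 *\<^sub>v \<rho>)"
    using transpose_word_mat_intertwines[OF X zero Q1 Q2 XQ, of vs, folded B1_def B2_def]
      assoc_mult_mat_vec[OF X B(1) \<rho>] assoc_mult_mat_vec[OF B(2) X \<rho>] by simp
  moreover have "symbol_mat k2 \<phi>2 w *\<^sub>v (X *\<^sub>v (B1 *\<^sub>v \<rho>)) = X *\<^sub>v (symbol_mat k1 \<phi>1 w *\<^sub>v (B1 *\<^sub>v \<rho>))"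
    using symbol_mat_intertwines[OF X zero, of w]
      assoc_mult_mat_vec[OF X C(1) v(1)] assoc_mult_mat_vec[OF C(2) X v(1)] by simp
  moreover have "word_mat k2 \<phi>2 Q2 us *\<^sub>v (X *\<^sub>v (symbol_mat k1 \<phi>1 w *\<^sub>v (B1 *\<^sub>v \<rho>))) =
      X *\<^sub>v (word_mat k1 \<phi>1 Q1 us *\<^sub>v (symbol_mat k1 \<phi>1 w *\<^sub>v (B1 *\<^sub>v \<rho>)))"
    using word_mat_intertwines[OF X zero Q1 Q2 XQ, of us]
      assoc_mult_mat_vec[OF X W(1) v(2)] assoc_mult_mat_vec[OF W(2) X v(2)] by simp
  ultimately show ?thesis
    unfolding joint_weight_def B1_def[symmetric] B2_def[symmetric]
    using transpose_vec_mult_scalar[OF X v(3), of "ones k2"] e by simp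
qed

section \<open>Tensor entries\<close>

text \<open>The summation index of the rank-one terms is a state. Slice \<open>w\<close> of the
  observation matrix keeps the states with symbol \<open>w\<close>, which is the mask standing
  between future and past in \<open>joint_weight\<close>.\<close>

lemma tensor3_of_mats_entry:
  assumes Q: "Q \<in> carrier_mat k k" and \<rho>: "\<rho> \<in> carrier_vec k"
    and A: "A \<in> carrier_mat a k" and B: "B \<in> carrier_mat b k"
    and ijw: "i < a" "j < b" "w < d"
    and rowA: "row A i = row_mult (ones k) (word_mat k \<phi> Q us)"
    and rowB: "row B j = row_mult \<rho> (word_mat k \<phi> (transpose_mat Q) vs)"
  shows "tensor3_of_mats A B (observation_mat d k \<phi>) i j w = joint_weight k \<phi> Q \<rho> us w vs"
proof -
  have Bj: "row B j \<in> carrier_vec k" using B by auto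
  have s: "(symbol_mat k \<phi> w *\<^sub>v row B j) \<in> carrier_vec k"
    using Bj by (meson mult_mat_vec_carrier symbol_mat_carrier)
  have "joint_weight k \<phi> Q \<rho> us w vs = scalar_prod (row A i) (symbol_mat k \<phi> w *\<^sub>v row B j)"
    unfolding joint_weight_def rowB[symmetric] rowA
    using transpose_vec_mult_scalar[OF word_mat_carrier[OF Q] s, of "ones k" \<phi> us] by simp
  also have "\<dots> = (\<Sum>r<k. A $$ (i, r) * (if \<phi> r = w then B $$ (j, r) else 0))"
    unfolding scalar_prod_def carrier_vecD[OF s] lessThan_atLeast0
  proof (rule sum.cong[OF refl])
    fix r assume "r \<in> {0..<k}"
    then show "row A i $ r * (symbol_mat k \<phi> w *\<^sub>v row B j) $ r =
        A $$ (i, r) * (if \<phi> r = w then B $$ (j, r) else 0)"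
      using A B ijw by (subst symbol_mat_mult_vec[OF Bj]) auto
  qed
  also have "\<dots> = tensor3_of_mats A B (observation_mat d k \<phi>) i j w"
    unfolding tensor3_of_mats_def rank_one_tensor3_def using A B ijw
    by (auto simp: observation_mat_def intro!: sum.cong)
  finally show ?thesis by simp
qed

lemma tensor3_of_mats_outside:
  assumes "A \<in> carrier_mat a r" "B \<in> carrier_mat b r" "C \<in> carrier_mat c r"
    and "\<not> (i < a \<and> j < b \<and> l < c)"
  shows "tensor3_of_mats A B C i j l = 0"
  using assms by (auto simp: tensor3_of_mats_def rank_one_tensor3_def)

section \<open>Words as base-\<open>d\<close> numerals\<close>

lemma word_index_Cons: "word_index d (u # us) = u * d ^ length us + word_index d us"
proof -
  have "word_index d (u # us) = (\<Sum>i<Suc (length us). (u # us) ! i * d ^ (length us - i))"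
    by (simp add: word_index_def)
  also have "\<dots> = u * d ^ length us + word_index d us"
    unfolding sum.lessThan_Suc_shift by (simp add: word_index_def)
  finally show ?thesis .
qed

text \<open>The quotient by \<open>d ^ n\<close> is the leading letter and the remainder encodes the
  other letters. It is needed because the rows of the factors are prescribed at word
  indices.\<close>

lemma word_index_surj:
  assumes "i < d ^ n"
  obtains us where "us \<in> words d n" "word_index d us = i"
  using assms
proof (induction n arbitrary: i thesis)
  case 0
  then show ?case by (intro "0.prems"(1)[of "[]"]) (auto simp: words_def word_index_def)
next
  case (Suc n)
  \<comment> \<open>If \<open>d = 0\<close>, then \<open>d ^ Suc n = 0\<close> and no index
    \<open>i\<close> exists.\<close>
  have pos: "d ^ n > 0" using Suc.prems(2) by (cases "d = 0") auto
  have "i div d ^ n < d"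
    using Suc.prems(2) by (simp add: less_mult_imp_div_less)
  moreover obtain us where "us \<in> words d n" "word_index d us = i mod d ^ n"
    using Suc.IH[of "i mod d ^ n"] pos by auto
  ultimately show ?case
    by (intro Suc.prems(1)[of "i div d ^ n # us"]) (auto simp: words_def word_index_Cons div_mult_mod_eq)
qed

text \<open>By \<open>e\<close> each column of \<open>X\<close> sums to one, and column
  \<open>j\<close> is supported on rows with symbol \<open>\<phi>1 j\<close>. Summing it over the
  rows with symbol \<open>i\<close> thus yields one or zero.\<close>

lemma observation_mat_intertwines:
  assumes X: "X \<in> carrier_mat k2 k1"
    and zero: "\<forall>i<k2. \<forall>j<k1. \<phi>2 i \<noteq> \<phi>1 j \<longrightarrow> X $$ (i, j) = 0"
    and e: "row_mult (ones k2) X = ones k1"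
  shows "observation_mat d k2 \<phi>2 * X = observation_mat d k1 \<phi>1"
proof (rule eq_matI)
  fix i j assume "i < dim_row (observation_mat d k1 \<phi>1)" "j < dim_col (observation_mat d k1 \<phi>1)"
  then have ij: "i < d" "j < k1" by (auto simp: observation_mat_def)
  have one: "(\<Sum>l = 0..<k2. X $$ (l, j)) = 1"
    using arg_cong[OF e, of "\<lambda>v. v $ j"] X ij by (simp add: scalar_prod_def)
  have "(observation_mat d k2 \<phi>2 * X) $$ (i, j) = (\<Sum>l = 0..<k2. (if \<phi>2 l = i then 1 else 0) * X $$ (l, j))"
    using X ij by (simp add: observation_mat_def scalar_prod_def)
  also have "\<dots> = (\<Sum>l = 0..<k2. if \<phi>1 j = i then X $$ (l, j) else 0)"
    using zero ij by (intro sum.cong) auto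
  also have "\<dots> = observation_mat d k1 \<phi>1 $$ (i, j)"
    using one ij by (simp add: observation_mat_def)
  finally show "(observation_mat d k2 \<phi>2 * X) $$ (i, j) = observation_mat d k1 \<phi>1 $$ (i, j)" .
qed (use X in \<open>auto simp: observation_mat_def\<close>)

section \<open>Path probabilities of a hidden Markov chain\<close>

text \<open>The Markov property in product form. Unlike the conditional form it makes sense for null
  histories too, where both sides vanish.\<close>

lemma markov_chain_path_step:
  assumes mc: "markov_chain P k Q x" and i: "i < k" and at: "a t < k"
  shows "\<P>(\<omega> in P. x (t + 1) \<omega> = i \<and> (\<forall>s\<in>{t - int m..t}. x s \<omega> = a s)) =
    Q $$ (i, a t) * \<P>(\<omega> in P. \<forall>s\<in>{t - int m..t}. x s \<omega> = a s)"
proof -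
  have fp: "finite_process P k x" using mc by (simp add: markov_chain_def)
  interpret prob_space P using fp by (simp add: finite_process_def)
  have [measurable]: "x t \<in> P \<rightarrow>\<^sub>M count_space {..<k}" for t
    using fp by (simp add: finite_process_def)
  have xn[measurable]: "x t \<in> P \<rightarrow>\<^sub>M count_space UNIV" for t
    by (rule measurable_compose[where g = "\<lambda>i. i" and N = "count_space {..<k}"]) auto
  define past where "past \<omega> \<longleftrightarrow> (\<forall>s\<in>{t - int m..t}. x s \<omega> = a s)" for \<omega>
  have [measurable]: "Measurable.pred P past"
    unfolding past_def by measurable
  show ?thesis
  proof (cases "\<P>(\<omega> in P. past \<omega>) = 0")
    case True
    have "\<P>(\<omega> in P. x (t + 1) \<omega> = i \<and> past \<omega>) \<le> \<P>(\<omega> in P. past \<omega>)"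
      by (rule finite_measure_mono) auto
    then have "\<P>(\<omega> in P. x (t + 1) \<omega> = i \<and> past \<omega>) = 0"
      using True by (simp add: measure_le_0_iff)
    then show ?thesis using True by (simp add: past_def)
  next
    case False
    \<comment> \<open>The history contains time \<open>t\<close>, so a non-null history forces a
      non-null present state and both conditional clauses of \<open>markov_chain\<close>
      apply.\<close>
    have "\<P>(\<omega> in P. past \<omega>) \<le> \<P>(\<omega> in P. x t \<omega> = a t)"
      by (rule finite_measure_mono) (auto simp: past_def)
    then have "\<P>(\<omega> in P. x t \<omega> = a t) \<noteq> 0"
      using False measure_nonneg[of P] by (smt (verit))
    then have "\<P>(\<omega> in P. x (t + 1) \<omega> = i \<bar> x t \<omega> = a t) = Q $$ (i, a t)"
      using mc i at by (simp add: markov_chain_def)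
    moreover have "\<P>(\<omega> in P. x (t + 1) \<omega> = i \<bar> past \<omega>) = \<P>(\<omega> in P. x (t + 1) \<omega> = i \<bar> x t \<omega> = a t)"
      using mc False unfolding markov_chain_def past_def by blast
    ultimately show ?thesis
      using False by (simp add: cond_prob_def past_def field_simps)
  qed
qed

text \<open>Observed symbols restrict states to sets rather than to single values. The Markov
  property extends to such histories once the present state \<open>j\<close> is pinned: the event
  splits into finitely many paths, all with the same transition factor.\<close>

lemma markov_chain_history_step:
  assumes mc: "markov_chain P k Q x" and i: "i < k"
  shows "\<P>(\<omega> in P. x (t + 1) \<omega> = i \<and> (\<forall>s\<in>{t - int m..t}. x s \<omega> \<in> S s)) =
    (\<Sum>j<k. Q $$ (i, j) * \<P>(\<omega> in P. x t \<omega> = j \<and> (\<forall>s\<in>{t - int m..t}. x s \<omega> \<in> S s)))"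
proof -
  have fp: "finite_process P k x" using mc by (simp add: markov_chain_def)
  interpret prob_space P using fp by (simp add: finite_process_def)
  have meas[measurable]: "x t \<in> P \<rightarrow>\<^sub>M count_space {..<k}" for t
    using fp by (simp add: finite_process_def)
  have xn[measurable]: "x t \<in> P \<rightarrow>\<^sub>M count_space UNIV" for t
    by (rule measurable_compose[where g = "\<lambda>i. i" and N = "count_space {..<k}"]) auto
  have xk: "x s \<omega> < k" if "\<omega> \<in> space P" for s \<omega>
    using measurable_space[OF meas that] by simp
  let ?I = "{t - int m..t}"
  have by_paths: "\<P>(\<omega> in P. E \<omega> \<and> (\<forall>s\<in>?I. x s \<omega> \<in> S s)) =
      (\<Sum>a\<in>PiE ?I (\<lambda>s. S s \<inter> {..<k}). \<P>(\<omega> in P. E \<omega> \<and> (\<forall>s\<in>?I. x s \<omega> = a s)))"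
    if [measurable]: "Measurable.pred P E" for E and S :: "int \<Rightarrow> nat set"
  proof (rule prob_sum)
    show "finite (PiE ?I (\<lambda>s. S s \<inter> {..<k}))" by (intro finite_PiE) auto
    show "AE \<omega> in P. (\<forall>a\<in>PiE ?I (\<lambda>s. S s \<inter> {..<k}). E \<omega> \<and> (\<forall>s\<in>?I. x s \<omega> = a s) \<longrightarrow>
         E \<omega> \<and> (\<forall>s\<in>?I. x s \<omega> \<in> S s)) \<and> (E \<omega> \<and> (\<forall>s\<in>?I. x s \<omega> \<in> S s) \<longrightarrow>
         (\<exists>!a. a \<in> PiE ?I (\<lambda>s. S s \<inter> {..<k}) \<and> (E \<omega> \<and> (\<forall>s\<in>?I. x s \<omega> = a s))))"
    proof (rule AE_I2, intro conjI impI ballI)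
      fix \<omega> assume \<omega>: "\<omega> \<in> space P" and ES: "E \<omega> \<and> (\<forall>s\<in>?I. x s \<omega> \<in> S s)"
      show "\<exists>!a. a \<in> PiE ?I (\<lambda>s. S s \<inter> {..<k}) \<and> (E \<omega> \<and> (\<forall>s\<in>?I. x s \<omega> = a s))"
      \<comment> \<open>The path is the trajectory cut down to the window; extensionality of
        \<open>PiE\<close> makes it unique.\<close>
      proof (rule ex1I[of _ "restrict (\<lambda>s. x s \<omega>) ?I"])
        show "restrict (\<lambda>s. x s \<omega>) ?I \<in> PiE ?I (\<lambda>s. S s \<inter> {..<k}) \<and>
            E \<omega> \<and> (\<forall>s\<in>?I. x s \<omega> = restrict (\<lambda>s. x s \<omega>) ?I s)"
          using ES xk[OF \<omega>] by auto
      next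
        fix a assume "a \<in> PiE ?I (\<lambda>s. S s \<inter> {..<k}) \<and> E \<omega> \<and> (\<forall>s\<in>?I. x s \<omega> = a s)"
        then show "a = restrict (\<lambda>s. x s \<omega>) ?I"
          by (intro ext) (auto simp: PiE_def extensional_def restrict_def)
      qed
    qed (auto simp: PiE_iff)
  qed measurable
  \<comment> \<open>With the present confined to \<open>{j}\<close>, every admissible path ends in
    \<open>j\<close>, so \<open>Q $$ (i, j)\<close> factors out of the sum.\<close>
  have last: "\<P>(\<omega> in P. x (t + 1) \<omega> = i \<and> (\<forall>s\<in>?I. x s \<omega> \<in> S s)) =
      Q $$ (i, j) * \<P>(\<omega> in P. \<forall>s\<in>?I. x s \<omega> \<in> S s)"
    if j: "j < k" and St: "S t \<subseteq> {j}" for j and S :: "int \<Rightarrow> nat set"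
  proof -
    have "a t = j" if "a \<in> PiE ?I (\<lambda>s. S s \<inter> {..<k})" for a
      using PiE_mem[OF that, of t] St by auto
    then have "\<P>(\<omega> in P. x (t + 1) \<omega> = i \<and> (\<forall>s\<in>?I. x s \<omega> = a s)) =
      Q $$ (i, j) * \<P>(\<omega> in P. \<forall>s\<in>?I. x s \<omega> = a s)" if "a \<in> PiE ?I (\<lambda>s. S s \<inter> {..<k})" for a
      using markov_chain_path_step[OF mc i, of a t m] j that by simp
    then show ?thesis
      using by_paths[of "\<lambda>\<omega>. x (t + 1) \<omega> = i" S] by_paths[of "\<lambda>\<omega>. True" S]
      by (simp add: sum_distrib_left)
  qed
  have "\<P>(\<omega> in P. x (t + 1) \<omega> = i \<and> (\<forall>s\<in>?I. x s \<omega> \<in> S s)) =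
      (\<Sum>j<k. \<P>(\<omega> in P. x (t + 1) \<omega> = i \<and> (x t \<omega> = j \<and> (\<forall>s\<in>?I. x s \<omega> \<in> S s))))"
    by (rule prob_sum) (use xk in \<open>auto intro!: AE_I2\<close>)
  also have "\<dots> = (\<Sum>j<k. Q $$ (i, j) * \<P>(\<omega> in P. x t \<omega> = j \<and> (\<forall>s\<in>?I. x s \<omega> \<in> S s)))"
  proof (rule sum.cong[OF refl])
    fix j assume "j \<in> {..<k}"
    \<comment> \<open>Shrinking the constraint at time \<open>t\<close> expresses the pinned present
      state as a set history.\<close>
    moreover have "(\<forall>s\<in>?I. x s \<omega> \<in> (S(t := S t \<inter> {j})) s) \<longleftrightarrow> x t \<omega> = j \<and> (\<forall>s\<in>?I. x s \<omega> \<in> S s)" for \<omega>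
      by auto
    ultimately show "\<P>(\<omega> in P. x (t + 1) \<omega> = i \<and> (x t \<omega> = j \<and> (\<forall>s\<in>?I. x s \<omega> \<in> S s))) =
        Q $$ (i, j) * \<P>(\<omega> in P. x t \<omega> = j \<and> (\<forall>s\<in>?I. x s \<omega> \<in> S s))"
      using last[of j "S(t := S t \<inter> {j})"] by (simp del: fun_upd_apply) simp
  qed
  finally show ?thesis .
qed

text \<open>This is the forward recursion for unnormalised filter probabilities: each new
  observation applies \<open>Q\<close> and then a mask. Time \<open>t\<close> itself is unobserved,
  so the recursion starts from the unmasked \<open>\<rho>\<close>.\<close>

lemma markov_chain_forward:
  assumes mc: "markov_chain P k Q x"
    and \<rho>: "\<rho> \<in> carrier_vec k" "\<forall>t. \<forall>i<k. \<rho> $ i = \<P>(\<omega> in P. x t \<omega> = i)"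
    and i: "i < k"
  shows "\<P>(\<omega> in P. x (t + int m) \<omega> = i \<and> (\<forall>s\<in>{t + 1..t + int m}. \<phi> (x s \<omega>) = u s)) =
    (word_mat k \<phi> Q (map u [t + 1..t + int m]) *\<^sub>v \<rho>) $ i"
  using i
proof (induction m arbitrary: i)
  case 0
  then show ?case using \<rho> by simp
next
  case (Suc m)
  have Q: "Q \<in> carrier_mat k k"
    using mc by (simp add: markov_chain_def column_stochastic_def)
  define r where "r = t + int m"
  \<comment> \<open>The history window starts at \<open>t\<close> but the observations start at
    \<open>t + 1\<close>, so \<open>t\<close> gets the trivial constraint.\<close>
  define S where "S s = (if s = t then UNIV else {j. \<phi> j = u s})" for s
  define v where "v = word_mat k \<phi> Q (map u [t + 1..r]) *\<^sub>v \<rho>"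
  have v: "v \<in> carrier_vec k"
    unfolding v_def using \<rho>(1) word_mat_carrier[OF Q] by (meson mult_mat_vec_carrier)
  have Suc_r: "t + int (Suc m) = r + 1" by (simp add: r_def)
  have S: "(\<forall>s\<in>{r - int m..r}. x s \<omega> \<in> S s) \<longleftrightarrow> (\<forall>s\<in>{t + 1..r}. \<phi> (x s \<omega>) = u s)" for \<omega>
    by (force simp: S_def r_def)
  have split: "{t + 1..r + 1} = insert (r + 1) {t + 1..r}"
    by (auto simp: r_def)
  have step: "\<P>(\<omega> in P. x (r + 1) \<omega> = i \<and> (\<forall>s\<in>{t + 1..r}. \<phi> (x s \<omega>) = u s)) = (Q *\<^sub>v v) $ i"
  proof -
    have "\<P>(\<omega> in P. x (r + 1) \<omega> = i \<and> (\<forall>s\<in>{t + 1..r}. \<phi> (x s \<omega>) = u s)) =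
        (\<Sum>j<k. Q $$ (i, j) * \<P>(\<omega> in P. x r \<omega> = j \<and> (\<forall>s\<in>{t + 1..r}. \<phi> (x s \<omega>) = u s)))"
      using markov_chain_history_step[OF mc Suc.prems, of r m S] by (simp only: S)
    also have "\<dots> = (\<Sum>j<k. Q $$ (i, j) * v $ j)"
      using Suc.IH by (simp add: r_def v_def)
    finally show ?thesis
      using Q v Suc.prems by (simp add: scalar_prod_def lessThan_atLeast0)
  qed
  \<comment> \<open>The newest letter ends the word and hence becomes the leftmost factor.\<close>
  have "map u [t + 1..r + 1] = map u [t + 1..r] @ [u (r + 1)]"
    using upto_rec2[of "t + 1" "r + 1"] by (simp add: r_def)
  then have "word_mat k \<phi> Q (map u [t + 1..r + 1]) =
      (symbol_mat k \<phi> (u (r + 1)) * Q) * word_mat k \<phi> Q (map u [t + 1..r])"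
    using Q by (simp add: word_mat_append left_mult_one_mat[OF mult_carrier_mat[OF symbol_mat_carrier Q]])
  then have "word_mat k \<phi> Q (map u [t + 1..r + 1]) *\<^sub>v \<rho> = symbol_mat k \<phi> (u (r + 1)) *\<^sub>v (Q *\<^sub>v v)"
    unfolding v_def
    using assoc_mult_mat_vec[OF mult_carrier_mat[OF symbol_mat_carrier Q] word_mat_carrier[OF Q] \<rho>(1)]
      assoc_mult_mat_vec[OF symbol_mat_carrier Q mult_mat_vec_carrier[OF word_mat_carrier[OF Q] \<rho>(1)]]
    by metis
  also have "(symbol_mat k \<phi> (u (r + 1)) *\<^sub>v (Q *\<^sub>v v)) $ i =
      (if \<phi> i = u (r + 1) then (Q *\<^sub>v v) $ i else 0)"
    by (rule symbol_mat_mult_vec[OF mult_mat_vec_carrier[OF Q v] Suc.prems])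
  also have "\<dots> = \<P>(\<omega> in P. x (r + 1) \<omega> = i \<and> (\<forall>s\<in>{t + 1..r + 1}. \<phi> (x s \<omega>) = u s))"
  proof (cases "\<phi> i = u (r + 1)")
    case True
    then have "(x (r + 1) \<omega> = i \<and> (\<forall>s\<in>{t + 1..r + 1}. \<phi> (x s \<omega>) = u s)) \<longleftrightarrow>
        x (r + 1) \<omega> = i \<and> (\<forall>s\<in>{t + 1..r}. \<phi> (x s \<omega>) = u s)" for \<omega>
      unfolding split by auto
    then show ?thesis using True step by simp
  next
    case False
    then have "{\<omega> \<in> space P. x (r + 1) \<omega> = i \<and> (\<forall>s\<in>{t + 1..r + 1}. \<phi> (x s \<omega>) = u s)} = {}"
      unfolding split by auto
    then show ?thesis using False by (simp only: measure_empty if_False)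
  qed
  finally show ?case by (simp only: Suc_r)
qed

text \<open>One transition with an unconstrained history maps the marginal at time 0 to that at time
  1, and both are \<open>\<rho>\<close>.\<close>

lemma markov_chain_stationary_vec:
  assumes mc: "markov_chain P k Q x"
    and \<rho>: "\<rho> \<in> carrier_vec k" "\<forall>t. \<forall>i<k. \<rho> $ i = \<P>(\<omega> in P. x t \<omega> = i)"
  shows "Q *\<^sub>v \<rho> = \<rho>"
proof (rule eq_vecI)
  have Q: "Q \<in> carrier_mat k k"
    using mc by (simp add: markov_chain_def column_stochastic_def)
  then show "dim_vec (Q *\<^sub>v \<rho>) = dim_vec \<rho>" using \<rho> by simp
  fix i assume "i < dim_vec \<rho>"
  then have i: "i < k" using \<rho> by simp
  have "\<rho> $ i = \<P>(\<omega> in P. x (0 + 1) \<omega> = i)"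
    using \<rho>(2) i by blast
  also have "\<dots> = (\<Sum>j<k. Q $$ (i, j) * \<P>(\<omega> in P. x 0 \<omega> = j))"
    using markov_chain_history_step[OF mc i, of 0 0 "\<lambda>_. UNIV"] by simp
  also have "\<dots> = (\<Sum>j<k. Q $$ (i, j) * \<rho> $ j)"
    using \<rho>(2) by simp
  also have "\<dots> = (Q *\<^sub>v \<rho>) $ i"
    using Q \<rho>(1) i by (simp add: scalar_prod_def lessThan_atLeast0)
  finally show "(Q *\<^sub>v \<rho>) $ i = \<rho> $ i" by simp
qed

text \<open>Both sides are the alternating product \<open>Q I_v1 Q ... I_vn Q\<close>, bracketed
  differently.\<close>

lemma transpose_word_mat_times:
  assumes Q: "Q \<in> carrier_mat k k"
  shows "transpose_mat (word_mat k \<phi> (transpose_mat Q) vs) * Q = Q * word_mat k \<phi> Q (rev vs)"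
proof (induction vs)
  case Nil
  show ?case using Q by simp
next
  case (Cons v vs)
  define W where "W = transpose_mat (word_mat k \<phi> (transpose_mat Q) vs)"
  have W: "W \<in> carrier_mat k k" using Q by (simp add: W_def)
  note C = symbol_mat_carrier[of k \<phi> v]
  note R = word_mat_carrier[OF Q, of \<phi> "rev vs"]
  have "transpose_mat (word_mat k \<phi> (transpose_mat Q) (v # vs)) * Q = (Q * (symbol_mat k \<phi> v * W)) * Q"
    by (simp only: transpose_word_mat_Cons[OF Q] W_def)
  also have "\<dots> = Q * (symbol_mat k \<phi> v * (W * Q))"
    by (simp add: assoc_mult_mat[OF Q mult_carrier_mat[OF C W] Q] assoc_mult_mat[OF C W Q])
  also have "\<dots> = Q * ((symbol_mat k \<phi> v * Q) * word_mat k \<phi> Q (rev vs))"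
    using Cons by (simp add: W_def[symmetric] assoc_mult_mat[OF C Q R])
  finally show ?case
    using Q by (simp add: word_mat_append left_mult_one_mat[OF mult_carrier_mat[OF C Q]])
qed

text \<open>Stationarity supplies the missing \<open>Q\<close> at the far end of the past, so past,
  middle and future merge into one word in chronological order.\<close>

lemma joint_weight_stationary:
  assumes Q: "Q \<in> carrier_mat k k" and \<rho>: "\<rho> \<in> carrier_vec k" and inv: "Q *\<^sub>v \<rho> = \<rho>"
  shows "joint_weight k \<phi> Q \<rho> us w vs =
    scalar_prod (ones k) (word_mat k \<phi> Q (rev vs @ w # us) *\<^sub>v \<rho>)"
proof -
  define W where "W = transpose_mat (word_mat k \<phi> (transpose_mat Q) vs)"
  have W: "W \<in> carrier_mat k k" using Q by (simp add: W_def)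
  note C = symbol_mat_carrier[of k \<phi> w]
  note R = word_mat_carrier[OF Q, of \<phi> "rev vs"]
  note U = word_mat_carrier[OF Q, of \<phi> us]
  have Rv: "word_mat k \<phi> Q (rev vs) *\<^sub>v \<rho> \<in> carrier_vec k"
    by (rule mult_mat_vec_carrier[OF R \<rho>])
  have "W *\<^sub>v \<rho> = (W * Q) *\<^sub>v \<rho>"
    using assoc_mult_mat_vec[OF W Q \<rho>] inv by simp
  also have "\<dots> = Q *\<^sub>v (word_mat k \<phi> Q (rev vs) *\<^sub>v \<rho>)"
    unfolding W_def transpose_word_mat_times[OF Q] using assoc_mult_mat_vec[OF Q R \<rho>] .
  \<comment> \<open>The \<open>Q\<close> released on the left of the past joins the mask of
    \<open>w\<close> to form an ordinary letter factor.\<close>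
  finally have "symbol_mat k \<phi> w *\<^sub>v (W *\<^sub>v \<rho>) =
      (symbol_mat k \<phi> w * Q) *\<^sub>v (word_mat k \<phi> Q (rev vs) *\<^sub>v \<rho>)"
    using assoc_mult_mat_vec[OF C Q Rv] by simp
  then have "word_mat k \<phi> Q us *\<^sub>v (symbol_mat k \<phi> w *\<^sub>v (W *\<^sub>v \<rho>)) =
      word_mat k \<phi> Q (w # us) *\<^sub>v (word_mat k \<phi> Q (rev vs) *\<^sub>v \<rho>)"
    using assoc_mult_mat_vec[OF U mult_carrier_mat[OF C Q] Rv] by simp
  also have "\<dots> = word_mat k \<phi> Q (rev vs @ w # us) *\<^sub>v \<rho>"
    unfolding word_mat_append[OF Q] by (rule assoc_mult_mat_vec[OF word_mat_carrier[OF Q] R \<rho>, symmetric])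
  finally show ?thesis by (simp add: joint_weight_def W_def)
qed

text \<open>Pairing the forward vector with the ones vector sums out the final state.\<close>

lemma hmm_path_prob:
  assumes mc: "markov_chain P k Q x"
    and \<rho>: "\<rho> \<in> carrier_vec k" "\<forall>t. \<forall>i<k. \<rho> $ i = \<P>(\<omega> in P. x t \<omega> = i)"
  shows "\<P>(\<omega> in P. \<forall>s\<in>{t + 1..t + int m}. \<phi> (x s \<omega>) = u s) =
    scalar_prod (ones k) (word_mat k \<phi> Q (map u [t + 1..t + int m]) *\<^sub>v \<rho>)"
proof -
  have fp: "finite_process P k x" using mc by (simp add: markov_chain_def)
  have Q: "Q \<in> carrier_mat k k"
    using mc by (simp add: markov_chain_def column_stochastic_def)
  interpret prob_space P using fp by (simp add: finite_process_def)
  have meas[measurable]: "x t \<in> P \<rightarrow>\<^sub>M count_space {..<k}" for t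
    using fp by (simp add: finite_process_def)
  have xn[measurable]: "x t \<in> P \<rightarrow>\<^sub>M count_space UNIV" for t
    by (rule measurable_compose[where g = "\<lambda>i. i" and N = "count_space {..<k}"]) auto
  have xk: "x s \<omega> < k" if "\<omega> \<in> space P" for s \<omega>
    using measurable_space[OF meas that] by simp
  have "\<P>(\<omega> in P. \<forall>s\<in>{t + 1..t + int m}. \<phi> (x s \<omega>) = u s) =
      (\<Sum>i<k. \<P>(\<omega> in P. x (t + int m) \<omega> = i \<and> (\<forall>s\<in>{t + 1..t + int m}. \<phi> (x s \<omega>) = u s)))"
    by (rule prob_sum) (use xk in \<open>auto intro!: AE_I2\<close>)
  also have "\<dots> = (\<Sum>i<k. (word_mat k \<phi> Q (map u [t + 1..t + int m]) *\<^sub>v \<rho>) $ i)"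
    using markov_chain_forward[OF mc \<rho>] by simp
  also have "\<dots> = scalar_prod (ones k) (word_mat k \<phi> Q (map u [t + 1..t + int m]) *\<^sub>v \<rho>)"
    using carrier_vecD[OF mult_mat_vec_carrier[OF word_mat_carrier[OF Q] \<rho>(1)]]
    by (simp only: scalar_prod_def lessThan_atLeast0) (simp add: index_vec)
  finally show ?thesis .
qed

text \<open>The event is a finite cylinder, so its probability is read off the law. Processes on
  different probability spaces can then be compared.\<close>

lemma process_law_path_prob:
  assumes "finite_process P d y" "finite J" "\<forall>t. u t < d"
  shows "\<P>(\<omega> in P. \<forall>t\<in>J. y t \<omega> = u t) =
    measure (process_law P d y) {f \<in> space (Pi\<^sub>M UNIV (\<lambda>_ :: int. count_space {..<d})). \<forall>t\<in>J. f t = u t}"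
proof -
  let ?N = "Pi\<^sub>M UNIV (\<lambda>_ :: int. count_space {..<d})"
  have y: "y t \<in> P \<rightarrow>\<^sub>M count_space {..<d}" for t
    using assms by (simp add: finite_process_def)
  have Y: "(\<lambda>\<omega> t. y t \<omega>) \<in> P \<rightarrow>\<^sub>M ?N"
    using y measurable_space[OF y] by (intro measurable_PiM_single') (auto simp: PiE_iff)
  have [measurable]: "(\<lambda>f. f t) \<in> ?N \<rightarrow>\<^sub>M count_space {..<d}" for t
    by (rule measurable_component_singleton) simp
  have [measurable]: "(\<lambda>f. f t) \<in> ?N \<rightarrow>\<^sub>M count_space UNIV" for t
    by (rule measurable_compose[where g = "\<lambda>i. i" and N = "count_space {..<d}"]) auto
  have S: "{f \<in> space ?N. \<forall>t\<in>J. f t = u t} \<in> sets ?N"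
    using assms(2) by measurable
  show ?thesis
    unfolding process_law_def measure_distr[OF Y S] using measurable_space[OF Y]
    by (auto intro!: arg_cong[where f = "measure P"])
qed

text \<open>Equality of laws moves the event to the hidden chain, the path formula gives one long
  word, and stationarity folds that word back around time 0.\<close>

lemma hmm_realization_joint_weight:
  assumes y: "stationary_process P d y" and hmm: "hmm_realization P y d P' x k \<phi> Ob Q"
    and \<rho>: "\<rho> \<in> carrier_vec k" "\<forall>t. \<forall>i<k. \<rho> $ i = \<P>(\<omega> in P'. x t \<omega> = i)"
    and u: "\<forall>t. u t < d"
  shows "\<P>(\<omega> in P. \<forall>t\<in>{- int n..int n}. y t \<omega> = u t) =
    joint_weight k \<phi> Q \<rho> (map u [1..int n]) (u 0) (map (\<lambda>t. u (- t)) [1..int n])"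
proof -
  have mc: "markov_chain P' k Q x" and fp: "finite_process P' k x"
    and \<phi>: "\<phi> \<in> {..<k} \<rightarrow> {..<d}" and law: "process_law P d y = process_law P' d (\<lambda>t \<omega>. \<phi> (x t \<omega>))"
    using hmm by (auto simp: hmm_realization_def stationary_process_def)
  have Q: "Q \<in> carrier_mat k k"
    using mc by (simp add: markov_chain_def column_stochastic_def)
  have "(\<lambda>\<omega>. \<phi> (x t \<omega>)) \<in> P' \<rightarrow>\<^sub>M count_space {..<d}" for t
    by (rule measurable_compose[where N = "count_space {..<k}"])
      (use fp \<phi> in \<open>auto simp: finite_process_def\<close>)
  then have fp': "finite_process P' d (\<lambda>t \<omega>. \<phi> (x t \<omega>))"
    using fp by (simp add: finite_process_def)
  have fpy: "finite_process P d y"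
    using y by (simp add: stationary_process_def)
  \<comment> \<open>The past word lists times \<open>-1, ..., -n\<close>; its reversal is
    chronological.\<close>
  have rev_neg: "rev (map (\<lambda>t. u (- t)) [1..int n]) = map u [- int n..- 1]"
  proof (induction n)
    case (Suc n)
    have "[1..int (Suc n)] = [1..int n] @ [int (Suc n)]"
      using upto_rec2[of 1 "int (Suc n)"] by simp
    moreover have "[- int (Suc n)..- 1] = (- int (Suc n)) # [- int n..- 1]"
      using upto_rec1[of "- int (Suc n)" "- 1"] by simp
    ultimately show ?case using Suc by simp
  qed simp
  \<comment> \<open>\<open>hmm_path_prob\<close> observes from \<open>t + 1\<close> on, so the
    window of length \<open>2 * n + 1\<close> is obtained with \<open>t = -n - 1\<close>.\<close>
  have range: "- int n - 1 + 1 = - int n" "- int n - 1 + int (2 * n + 1) = int n" by auto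
  have "\<P>(\<omega> in P. \<forall>t\<in>{- int n..int n}. y t \<omega> = u t) =
      \<P>(\<omega> in P'. \<forall>t\<in>{- int n..int n}. \<phi> (x t \<omega>) = u t)"
    using process_law_path_prob[OF fpy _ u, of "{- int n..int n}"]
      process_law_path_prob[OF fp' _ u, of "{- int n..int n}"] law by simp
  also have "\<dots> = scalar_prod (ones k) (word_mat k \<phi> Q (map u [- int n..int n]) *\<^sub>v \<rho>)"
    using hmm_path_prob[OF mc \<rho>, of "- int n - 1" "2 * n + 1" \<phi> u] by (simp only: range)
  also have "map u [- int n..int n] = rev (map (\<lambda>t. u (- t)) [1..int n]) @ u 0 # map u [1..int n]"
    unfolding rev_neg using upto_split3[of "- int n" 0 "int n"] by simp
  also have "scalar_prod (ones k) (word_mat k \<phi> Q \<dots> *\<^sub>v \<rho>) =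
      joint_weight k \<phi> Q \<rho> (map u [1..int n]) (u 0) (map (\<lambda>t. u (- t)) [1..int n])"
    using joint_weight_stationary[OF Q \<rho>(1) markov_chain_stationary_vec[OF mc \<rho>]] by simp
  finally show ?thesis .
qed

section \<open>Equality of the three tensors\<close>

theorem theorem9:
  fixes P :: "'a measure" and y :: "int \<Rightarrow> 'a \<Rightarrow> nat"
    and P' :: "'b measure" and x :: "int \<Rightarrow> 'b \<Rightarrow> nat"
    and d k n kR kN kh :: nat
    and \<phi> \<phi>R \<phi>N \<phi>h :: "nat \<Rightarrow> nat"
    and Ob Q TR TN QR OR T Qh Oh A B C Ah Bh Ch :: "real mat"
    and \<rho> \<rho>R \<rho>h :: "real vec"
    and VR VN :: "real vec set"
    and M :: tensor3
  assumes y: "stationary_process P d y"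
    and hmm: "hmm_realization P y d P' x k \<phi> Ob Q"
    and rho: "\<rho> \<in> carrier_vec k" "\<forall>t. \<forall>i<k. \<rho> $ i = \<P>(\<omega> in P'. x t \<omega> = i)"
    and n: "n \<ge> 1"
    \<comment> \<open>the tensor and its factors\<close>
    and M: "M \<in> carrier_tensor3 (d ^ n) (d ^ n) d"
      "\<forall>u :: int \<Rightarrow> nat. (\<forall>t. u t < d) \<longrightarrow>
         M (word_index d (map u [1..int n])) (word_index d (map (\<lambda>t. u (- t)) [1..int n])) (u 0) =
         \<P>(\<omega> in P. \<forall>t\<in>{- int n..int n}. y t \<omega> = u t)"
    and A: "A \<in> carrier_mat (d ^ n) k"
      "\<forall>us\<in>words d n. row A (word_index d us) = row_mult (ones k) (word_mat k \<phi> Q us)"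
    and B: "B \<in> carrier_mat (d ^ n) k"
      "\<forall>us\<in>words d n. row B (word_index d us) = row_mult \<rho> (word_mat k \<phi> (transpose_mat Q) us)"
    and C: "C = Ob"
    \<comment> \<open>reachable and null spaces\<close>
    and VR: "VR = reachable_space d k \<phi> Q \<rho>"
    and VN: "VN = null_space d k \<phi> Q"
    and VRu: "\<forall>u<d. \<not> (\<lambda>v. symbol_mat k \<phi> u *\<^sub>v v) ` VR \<subseteq> {v \<in> carrier_vec k. scalar_prod (ones k) v = 0}"
    and kR: "kR = vdim k VR"
    and TR: "TR \<in> carrier_mat k kR" "vec_space.rank k TR = kR" "\<phi>R \<in> {..<kR} \<rightarrow> {..<d}"
      "\<forall>i<k. \<forall>j<kR. \<phi> i \<noteq> \<phi>R j \<longrightarrow> TR $$ (i, j) = 0"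
      "VR = vec_space.col_space k TR"
      "row_mult (ones k) TR = ones kR"
    and kN: "kN = k - vdim k VN"
    and TN: "TN \<in> carrier_mat kN k" "vec_space.rank kN TN = kN" "\<phi>N \<in> {..<kN} \<rightarrow> {..<d}"
      "\<forall>i<kN. \<forall>j<k. \<phi>N i \<noteq> \<phi> j \<longrightarrow> TN $$ (i, j) = 0"
      "VN = mat_kernel TN"
      "ones k = row_mult (ones kN) TN"
    and QR: "QR \<in> carrier_mat kR kR" "Q * TR = TR * QR"
    and OR: "OR = Ob * TR"
    and rhoR: "\<rho>R \<in> carrier_vec kR" "\<rho> = TR *\<^sub>v \<rho>R"
    \<comment> \<open>the reduction to the effective space\<close>
    and kh: "kh = quot_dim k (vec_set_sum VR VN) VN"
    and T: "T \<in> carrier_mat kh kR" "vec_space.rank kh T = kh" "\<phi>h \<in> {..<kh} \<rightarrow> {..<d}"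
      "\<forall>i<kh. \<forall>j<kR. \<phi>h i \<noteq> \<phi>R j \<longrightarrow> T $$ (i, j) = 0"
      "mat_kernel T = mat_kernel (TN * TR)"
      "ones kR = row_mult (ones kh) T"
      "\<forall>v\<in>mat_kernel T. QR *\<^sub>v v \<in> mat_kernel T"
    and Qh: "Qh \<in> carrier_mat kh kh" "Qh * T = T * QR"
    and Oh: "Oh \<in> carrier_mat d kh" "Oh * T = OR"
    and rhoh: "\<rho>h = T *\<^sub>v \<rho>R"
    and Ah: "Ah \<in> carrier_mat (d ^ n) kh"
      "\<forall>us\<in>words d n. row Ah (word_index d us) = row_mult (ones kh) (word_mat kh \<phi>h Qh us)"
    and Bh: "Bh \<in> carrier_mat (d ^ n) kh"
      "\<forall>us\<in>words d n. row Bh (word_index d us) = row_mult \<rho>h (word_mat kh \<phi>h (transpose_mat Qh) us)"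
    and Ch: "Ch = Oh"
  shows "M = tensor3_of_mats A B C \<and> tensor3_of_mats A B C = tensor3_of_mats Ah Bh Ch"
proof -
  have Q: "Q \<in> carrier_mat k k" and Ob: "Ob = observation_mat d k \<phi>"
    using hmm by (auto simp: hmm_realization_def markov_chain_def column_stochastic_def)
  have obs_carrier: "observation_mat d k' \<psi> \<in> carrier_mat d k'" for k' \<psi>
    by (simp add: observation_mat_def)
  \<comment> \<open>Multiplied by \<open>T\<close>, both sides become the observation matrix of
    \<open>\<phi>R\<close>: for \<open>Oh\<close> this goes through \<open>TR\<close>, for the other
    side through \<open>T\<close> itself.\<close>
  have "Oh = observation_mat d kh \<phi>h"
  proof (rule full_row_rank_cancel[OF T(1,2) Oh(1) obs_carrier])
    show "Oh * T = observation_mat d kh \<phi>h * T"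
      using Oh(2) OR Ob observation_mat_intertwines[OF TR(1,4,6)] observation_mat_intertwines[OF T(1,4) T(6)[symmetric]]
      by simp
  qed
  then have Oh': "Ch = observation_mat d kh \<phi>h" using Ch by simp
  have rhoh_c: "\<rho>h \<in> carrier_vec kh"
    unfolding rhoh by (rule mult_mat_vec_carrier[OF T(1) rhoR(1)])
  have entries: "M i j w = tensor3_of_mats A B C i j w \<and>
      tensor3_of_mats A B C i j w = tensor3_of_mats Ah Bh Ch i j w" for i j w
  proof (cases "i < d ^ n \<and> j < d ^ n \<and> w < d")
    case False
    then show ?thesis
      using M(1) tensor3_of_mats_outside[OF A(1) B(1) obs_carrier]
        tensor3_of_mats_outside[OF Ah(1) Bh(1) obs_carrier]
      by (simp add: carrier_tensor3_def C Ob Oh')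
  next
    case True
    then have ijw: "i < d ^ n" "j < d ^ n" "w < d" by auto
    obtain us where us: "us \<in> words d n" "word_index d us = i"
      using word_index_surj[OF ijw(1)] by blast
    obtain vs where vs: "vs \<in> words d n" "word_index d vs = j"
      using word_index_surj[OF ijw(2)] by blast
    \<comment> \<open>A two-sided symbol sequence with \<open>us\<close> at times
      \<open>1..n\<close> and \<open>vs\<close> read backwards from time \<open>-1\<close>; the
      shift by one matches zero-based lists. The default \<open>w\<close> serves time 0 and keeps
      \<open>u\<close> below \<open>d\<close> outside the window, as \<open>M(2)\<close>
      demands.\<close>
    define u where "u t = (if t \<in> {1..int n} then us ! nat (t - 1)
      else if - t \<in> {1..int n} then vs ! nat (- t - 1) else w)" for t
    have len: "length us = n" "length vs = n" "set us \<subseteq> {..<d}" "set vs \<subseteq> {..<d}"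
      using us vs by (auto simp: words_def)
    have "us ! l < d" "vs ! l < d" if "l < n" for l
      using subsetD[OF len(3) nth_mem[of l us]] subsetD[OF len(4) nth_mem[of l vs]] len(1,2) that
      by simp_all
    then have ud: "\<forall>t. u t < d"
      using ijw(3) by (auto simp: u_def)
    have u_us: "map u [1..int n] = us"
      by (rule nth_equalityI) (auto simp: len u_def)
    have u_vs: "map (\<lambda>t. u (- t)) [1..int n] = vs"
      by (rule nth_equalityI) (auto simp: len u_def)
    have u0: "u 0 = w" by (simp add: u_def)
    have "M i j w = joint_weight k \<phi> Q \<rho> us w vs"
      using M(2)[rule_format, of u] ud hmm_realization_joint_weight[OF y hmm rho ud, of n]
      unfolding u_us u_vs u0 us vs by simp
    moreover have "tensor3_of_mats A B C i j w = joint_weight k \<phi> Q \<rho> us w vs"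
      unfolding C Ob using A(2) B(2) us vs by (intro tensor3_of_mats_entry[OF Q rho(1) A(1) B(1) ijw]) auto
    moreover have "tensor3_of_mats Ah Bh Ch i j w = joint_weight kh \<phi>h Qh \<rho>h us w vs"
      unfolding Oh' using Ah(2) Bh(2) us vs
      by (intro tensor3_of_mats_entry[OF Qh(1) rhoh_c Ah(1) Bh(1) ijw]) auto
    \<comment> \<open>The reachable realization is the common source: \<open>TR\<close> maps it to
      the given one and \<open>T\<close> to the reduced one.\<close>
    moreover have "joint_weight k \<phi> Q \<rho> us w vs = joint_weight kR \<phi>R QR \<rho>R us w vs"
      unfolding rhoR(2)
      by (rule joint_weight_intertwines[OF TR(1,4) QR(1) Q QR(2)[symmetric] TR(6) rhoR(1)])
    moreover have "joint_weight kh \<phi>h Qh \<rho>h us w vs = joint_weight kR \<phi>R QR \<rho>R us w vs"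
      unfolding rhoh
      by (rule joint_weight_intertwines[OF T(1,4) QR(1) Qh(1) Qh(2)[symmetric] T(6)[symmetric] rhoR(1)])
    ultimately show ?thesis by simp
  qed
  then show ?thesis by (auto intro!: ext)
qed

end
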